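(* For every finite graph $G$ with maximum degree $\Delta(G)$, we have $$\chi_{\mathrm{ss}}'(G) \le \Delta(G)^2,$$ where $\chi_{\mathrm{ss}}'(G)$ denotes the semistrong chromatic index of $G$.
   Context: Graphs are finite and without loops; parallel edges are allowed, and degrees count edges with multiplicity. A proper edge-coloring assigns colors to edges so that any two distinct edges sharing an endvertex receive distinct colors. For a set $M$ of edges, $V(M)$ is the set of endvertices of edges of $M$, and $G[V(M)]$ is the subgraph of $G$ induced by $V(M)$. A matching $M$ in a simple graph $G$ is semistrong if every edge of $M$ has an endvertex of degree one in $G[V(M)]$. A semistrong edge-coloring of a simple graph $G$ is a proper edge-coloring in which the edges of every color class form a semistrong matching. If $G$ has parallel edges, a semistrong edge-coloring of $G$ is a proper edge-coloring of $G$ in which the edges of every color class form a semistrong matching in the underlying simple graph of $G$ (the graph in which every two vertices adjacent in $G$ are joined by exactly one edge). The semistrong chromatic index $\chi_{\mathrm{ss}}'(G)$ is the least integer $k$ such that $G$ admits a semistrong edge-coloring with at most $k$ colors. *)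

theory Defs
  imports Main
begin

record ('v, 'e) multigraph =
  verts :: "'v set"
  edges :: "'e set"
  ends :: "'e \<Rightarrow> 'v set"

text \<open>Finite loopless graphs. Edges are named objects, so that parallel edges are distinct edges
  with the same set of ends; having exactly two ends excludes loops.\<close>

definition finite_graph :: "('v, 'e) multigraph \<Rightarrow> bool" where
  "finite_graph G \<longleftrightarrow> finite (verts G) \<and> finite (edges G) \<and>
     (\<forall>e\<in>edges G. ends G e \<subseteq> verts G \<and> card (ends G e) = 2)"

definition simple_graph :: "('v, 'e) multigraph \<Rightarrow> bool" where
  "simple_graph G \<longleftrightarrow> finite_graph G \<and> inj_on (ends G) (edges G)"

definition degree :: "('v, 'e) multigraph \<Rightarrow> 'v \<Rightarrow> nat" where
  "degree G v = card {e \<in> edges G. v \<in> ends G e}"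

text \<open>Inserting \<open>0\<close> only matters for the graph without vertices, whose maximum degree is
  taken to be \<open>0\<close>.\<close>

definition max_degree :: "('v, 'e) multigraph \<Rightarrow> nat" where
  "max_degree G = Max (insert 0 (degree G ` verts G))"

definition underlying_simple :: "('v, 'e) multigraph \<Rightarrow> ('v, 'v set) multigraph" where
  "underlying_simple G = \<lparr>verts = verts G, edges = ends G ` edges G, ends = (\<lambda>e. e)\<rparr>"

definition induced_subgraph :: "('v, 'e) multigraph \<Rightarrow> 'v set \<Rightarrow> ('v, 'e) multigraph" where
  "induced_subgraph G S =
     \<lparr>verts = verts G \<inter> S, edges = {e \<in> edges G. ends G e \<subseteq> S}, ends = ends G\<rparr>"

definition endvertices :: "('v, 'e) multigraph \<Rightarrow> 'e set \<Rightarrow> 'v set" where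
  "endvertices G M = (\<Union>e\<in>M. ends G e)"

definition matching :: "('v, 'e) multigraph \<Rightarrow> 'e set \<Rightarrow> bool" where
  "matching G M \<longleftrightarrow> M \<subseteq> edges G \<and>
     (\<forall>e\<in>M. \<forall>f\<in>M. e \<noteq> f \<longrightarrow> ends G e \<inter> ends G f = {})"

definition semistrong_matching :: "('v, 'e) multigraph \<Rightarrow> 'e set \<Rightarrow> bool" where
  "semistrong_matching G M \<longleftrightarrow> matching G M \<and>
     (\<forall>e\<in>M. \<exists>v\<in>ends G e. degree (induced_subgraph G (endvertices G M)) v = 1)"

definition proper_edge_coloring :: "('v, 'e) multigraph \<Rightarrow> ('e \<Rightarrow> 'c) \<Rightarrow> bool" where
  "proper_edge_coloring G c \<longleftrightarrow>
     (\<forall>e\<in>edges G. \<forall>f\<in>edges G. e \<noteq> f \<and> ends G e \<inter> ends G f \<noteq> {} \<longrightarrow> c e \<noteq> c f)"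

definition color_class :: "('v, 'e) multigraph \<Rightarrow> ('e \<Rightarrow> 'c) \<Rightarrow> 'c \<Rightarrow> 'e set" where
  "color_class G c i = {e \<in> edges G. c e = i}"

text \<open>A color class is viewed in the underlying simple graph through the images of its edges.
  For simple graphs this agrees with requiring the classes to be semistrong matchings of the
  graph itself, see \<open>semistrong_edge_coloring_simple\<close> below.\<close>

definition semistrong_edge_coloring :: "('v, 'e) multigraph \<Rightarrow> ('e \<Rightarrow> 'c) \<Rightarrow> bool" where
  "semistrong_edge_coloring G c \<longleftrightarrow> proper_edge_coloring G c \<and>
     (\<forall>i. semistrong_matching (underlying_simple G) (ends G ` color_class G c i))"

definition semistrong_chromatic_index :: "('v, 'e) multigraph \<Rightarrow> nat" where
  "semistrong_chromatic_index G =
     (LEAST k. \<exists>c :: 'e \<Rightarrow> nat. semistrong_edge_coloring G c \<and> card (c ` edges G) \<le> k)"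

lemma semistrong_matching_underlying_simple:
  assumes "simple_graph G" and M: "M \<subseteq> edges G"
  shows "semistrong_matching (underlying_simple G) (ends G ` M) \<longleftrightarrow> semistrong_matching G M"
proof -
  have inj: "inj_on (ends G) (edges G)"
    using assms(1) by (simp add: simple_graph_def)
  have eq: "ends G e = ends G f \<longleftrightarrow> e = f" if "e \<in> M" "f \<in> M" for e f
    using inj M that by (meson inj_onD subsetD)
  have V: "endvertices (underlying_simple G) (ends G ` M) = endvertices G M"
    by (simp add: endvertices_def underlying_simple_def)
  have deg: "degree (induced_subgraph (underlying_simple G) S) v = degree (induced_subgraph G S) v"
    for S v
  proof -
    have "{e \<in> edges (induced_subgraph (underlying_simple G) S).
             v \<in> ends (induced_subgraph (underlying_simple G) S) e} =
          ends G ` {e \<in> edges (induced_subgraph G S). v \<in> ends (induced_subgraph G S) e}"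
      by (auto simp: induced_subgraph_def underlying_simple_def)
    moreover have "inj_on (ends G)
        {e \<in> edges (induced_subgraph G S). v \<in> ends (induced_subgraph G S) e}"
      by (rule inj_on_subset[OF inj]) (auto simp: induced_subgraph_def)
    ultimately show ?thesis
      by (simp add: degree_def card_image)
  qed
  have "matching (underlying_simple G) (ends G ` M) \<longleftrightarrow> matching G M"
    unfolding matching_def underlying_simple_def using M
    by (simp add: eq image_mono cong: ball_cong)
  then show ?thesis
    by (simp add: semistrong_matching_def V deg) (simp add: underlying_simple_def)
qed

lemma semistrong_edge_coloring_simple:
  assumes "simple_graph G"
  shows "semistrong_edge_coloring G c \<longleftrightarrow>
    proper_edge_coloring G c \<and> (\<forall>i. semistrong_matching G (color_class G c i))"
  using semistrong_matching_underlying_simple[OF assms]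
  by (simp add: semistrong_edge_coloring_def color_class_def)

text \<open>The minimum in the definition of the index is over a nonempty set: coloring all edges
  differently is always possible.\<close>

lemma semistrong_edge_coloring_inj:
  assumes "finite_graph G" and c: "inj_on c (edges G)"
  shows "semistrong_edge_coloring G c"
proof -
  have "semistrong_matching (underlying_simple G) (ends G ` color_class G c i)" for i
  proof (cases "color_class G c i = {}")
    case True
    then show ?thesis by (simp add: semistrong_matching_def matching_def)
  next
    case False
    then obtain e where e: "e \<in> edges G" "c e = i" by (auto simp: color_class_def)
    have cls: "color_class G c i = {e}"
      using e c by (auto simp: color_class_def inj_on_def)
    have c2: "card (ends G f) = 2" if "f \<in> edges G" for f
      using assms(1) that by (simp add: finite_graph_def)
    have fin: "finite (ends G e)" using c2[OF e(1)] by (metis card.infinite zero_neq_numeral)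
    obtain v where v: "v \<in> ends G e" using c2[OF e(1)] by fastforce
    have "{f \<in> ends G ` edges G. f \<subseteq> ends G e \<and> v \<in> f} = {ends G e}"
      using e v fin c2 by (auto dest!: card_subset_eq[OF fin])
    then have "degree (induced_subgraph (underlying_simple G) (ends G e)) v = 1"
      by (simp add: degree_def induced_subgraph_def underlying_simple_def conj_assoc)
    then show ?thesis
      using e v by (auto simp: cls semistrong_matching_def matching_def endvertices_def
          underlying_simple_def)
  qed
  then show ?thesis
    using c by (auto simp: semistrong_edge_coloring_def proper_edge_coloring_def inj_on_def)
qed

lemma semistrong_chromatic_index_attained:
  fixes G :: "('v, 'e) multigraph"
  assumes "finite_graph G"
  shows "\<exists>c :: 'e \<Rightarrow> nat. semistrong_edge_coloring G c \<and>
    card (c ` edges G) \<le> semistrong_chromatic_index G"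
proof -
  have "finite (edges G)" using assms by (simp add: finite_graph_def)
  then obtain c :: "'e \<Rightarrow> nat" where "inj_on c (edges G)"
    by (meson finite_imp_inj_to_nat_seg)
  then have "\<exists>k. \<exists>c :: 'e \<Rightarrow> nat. semistrong_edge_coloring G c \<and> card (c ` edges G) \<le> k"
    using semistrong_edge_coloring_inj[OF assms] by blast
  then show ?thesis
    unfolding semistrong_chromatic_index_def by (rule LeastI_ex)
qed

end

(* Give two distinct edges e and f the weight w(e,f), the number of pairs of adjacent vertices
   (x,y) with x an end of e and y an end of f. Summing over the other edges f gives at most
   2 * Delta^2 - 2. Among all colorings with Delta^2 colors take one of minimal total
   monochromatic weight: recoloring a single edge e cannot help, so by averaging over the colors
   the weight from e to the rest of its color class is less than 2. Incident edges have weight at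
   least 2, so the coloring is proper, and weight at most 1 means that some end of e has no
   neighbor in the rest of the class. *)

theory Submission
  imports Defs
begin

section \<open>Locally optimal colorings for symmetric weights\<close>

text \<open>A coloring of minimal total monochromatic weight works: no color \<open>i\<close> gives
  \<open>e\<close> less weight to its class than \<open>c e\<close> does, and the weights from
  \<open>e\<close> to the \<open>k\<close> classes add up to its total weight.\<close>

lemma exists_locally_optimal_coloring:
  fixes w :: "'e \<Rightarrow> 'e \<Rightarrow> nat" and k :: nat
  assumes fin: "finite E" and sym: "\<And>e f. w e f = w f e" and "k > 0"
  obtains c :: "'e \<Rightarrow> nat" where "c ` E \<subseteq> {..<k}"
    "\<And>e. e \<in> E \<Longrightarrow> k * (\<Sum>f\<in>{f\<in>E-{e}. c f = c e}. w e f) \<le> (\<Sum>f\<in>E-{e}. w e f)"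
proof -
  define A where "A c e i = (\<Sum>f\<in>E-{e}. if c f = i then w e f else 0)" for c :: "'e \<Rightarrow> nat" and e i
  define W where "W c = (\<Sum>e\<in>E. A c e (c e))" for c
  have "(\<lambda>_. 0::nat) ` E \<subseteq> {..<k}" using \<open>k > 0\<close> by auto
  then obtain c :: "'e \<Rightarrow> nat" where c: "c ` E \<subseteq> {..<k}"
    and min: "\<And>c'. c' ` E \<subseteq> {..<k} \<Longrightarrow> W c \<le> W c'"
    using ex_has_least_nat[of "\<lambda>c. c ` E \<subseteq> {..<k}" "\<lambda>_. 0" W] by metis
  have opt: "A c e (c e) \<le> A c e i" if e: "e \<in> E" and i: "i < k" for e i
  proof -
    define R where "R = (\<Sum>g\<in>E-{e}. \<Sum>f\<in>E-{g}-{e}. if c f = c g then w g f else 0)"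
    \<comment> \<open>Only the color of \<open>e\<close> may differ in \<open>c'\<close>. Since
      \<open>W\<close> runs over ordered pairs, \<open>sym\<close> makes every pair containing
      \<open>e\<close> count twice, whence the factor 2; \<open>R\<close> collects the pairs
      avoiding \<open>e\<close>, which recoloring \<open>e\<close> leaves unchanged.\<close>
    have split: "W c' = 2 * A c e (c' e) + R" if c': "\<And>f. f \<noteq> e \<Longrightarrow> c' f = c f" for c'
    proof -
      have "A c' g (c' g) = (if c g = c' e then w e g else 0) +
          (\<Sum>f\<in>E-{g}-{e}. if c f = c g then w g f else 0)" if g: "g \<in> E - {e}" for g
      proof -
        have "A c' g (c' g) = (if c' e = c' g then w g e else 0) +
          (\<Sum>f\<in>E-{g}-{e}. if c' f = c' g then w g f else 0)"
          unfolding A_def using fin e g by (subst sum.remove[of _ e]) auto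
        moreover have "(\<Sum>f\<in>E-{g}-{e}. if c' f = c' g then w g f else 0) =
            (\<Sum>f\<in>E-{g}-{e}. if c f = c g then w g f else 0)"
          using g by (intro sum.cong) (auto simp: c')
        ultimately show ?thesis using g by (auto simp: c' sym)
      qed
      then have "(\<Sum>g\<in>E-{e}. A c' g (c' g)) = A c e (c' e) + R"
        by (simp add: A_def R_def sum.distrib)
      moreover have "A c' e (c' e) = A c e (c' e)"
        unfolding A_def by (intro sum.cong) (auto simp: c')
      ultimately show ?thesis
        unfolding W_def using fin e by (subst sum.remove[of _ e]) auto
    qed
    have "W c \<le> W (c(e := i))" using c i by (intro min) auto
    then show ?thesis using split[of c] split[of "c(e := i)"] by simp
  qed
  have "k * (\<Sum>f\<in>{f\<in>E-{e}. c f = c e}. w e f) \<le> (\<Sum>f\<in>E-{e}. w e f)" if e: "e \<in> E" for e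
  proof -
    have "(\<Sum>f\<in>{f\<in>E-{e}. c f = c e}. w e f) = A c e (c e)"
      unfolding A_def using fin by (subst sum.inter_filter) auto
    then have "k * (\<Sum>f\<in>{f\<in>E-{e}. c f = c e}. w e f) = (\<Sum>i<k. A c e (c e))" by simp
    also have "\<dots> \<le> (\<Sum>i<k. A c e i)" using e by (intro sum_mono opt) auto
    also have "\<dots> = (\<Sum>f\<in>E-{e}. \<Sum>i<k. if c f = i then w e f else 0)"
      unfolding A_def by (rule sum.swap)
    \<comment> \<open>Every \<open>f\<close> has exactly one color below \<open>k\<close>, so its
      inner sum is \<open>w e f\<close>.\<close>
    also have "\<dots> = (\<Sum>f\<in>E-{e}. w e f)"
      using c by (intro sum.cong) auto
    finally show ?thesis .
  qed
  with c show ?thesis using that by blast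
qed

section \<open>Neighborhoods and the edge weight\<close>

definition neighbors :: "('v, 'e) multigraph \<Rightarrow> 'v \<Rightarrow> 'v set" where
  "neighbors G x = {y. \<exists>g\<in>edges G. ends G g = {x, y}}"

definition edge_weight :: "('v, 'e) multigraph \<Rightarrow> 'e \<Rightarrow> 'e \<Rightarrow> nat" where
  "edge_weight G e f = (\<Sum>x\<in>ends G e. card (neighbors G x \<inter> ends G f))"

context
  fixes G :: "('v, 'e) multigraph"
  assumes G: "finite_graph G"
begin

lemma finite_edges: "finite (edges G)"
  using G by (simp add: finite_graph_def)

lemma finite_ends: "e \<in> edges G \<Longrightarrow> finite (ends G e)"
  using G by (auto simp: finite_graph_def intro: card_ge_0_finite)

lemma ends_other:
  assumes "e \<in> edges G" "x \<in> ends G e"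
  obtains y where "y \<noteq> x" "ends G e = {x, y}"
proof -
  have "card (ends G e) = 2" using G assms by (simp add: finite_graph_def)
  then show ?thesis
    using assms(2) that by (metis card_2_iff insertE insert_commute singletonD)
qed

lemma not_self_neighbor: "x \<notin> neighbors G x"
proof
  assume "x \<in> neighbors G x"
  then obtain g where g: "g \<in> edges G" "ends G g = {x}" by (auto simp: neighbors_def)
  then show False using ends_other[of g x] by auto
qed

text \<open>Indexing the neighbors by incident edges yields both their finiteness and the bound by
  the degree.\<close>

lemma neighbors_eq: "neighbors G x = (\<Union>g\<in>{g \<in> edges G. x \<in> ends G g}. ends G g - {x})"
proof (intro equalityI subsetI)
  fix y assume y: "y \<in> neighbors G x"
  then have "y \<noteq> x" using not_self_neighbor by blast
  with y show "y \<in> (\<Union>g\<in>{g \<in> edges G. x \<in> ends G g}. ends G g - {x})"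
    by (force simp: neighbors_def)
next
  fix y assume "y \<in> (\<Union>g\<in>{g \<in> edges G. x \<in> ends G g}. ends G g - {x})"
  then obtain g where g: "g \<in> edges G" "x \<in> ends G g" "y \<in> ends G g" "y \<noteq> x" by blast
  then have "ends G g = {x, y}" using ends_other[OF g(1,2)] by blast
  with g show "y \<in> neighbors G x" by (auto simp: neighbors_def)
qed

lemma finite_neighbors: "finite (neighbors G x)"
  unfolding neighbors_eq using finite_edges finite_ends by auto

lemma degree_le_max_degree: "degree G x \<le> max_degree G"
proof (cases "x \<in> verts G")
  case True
  then show ?thesis using G unfolding max_degree_def finite_graph_def by (intro Max_ge) auto
next
  case False
  \<comment> \<open>The maximum ranges over \<open>verts G\<close> only; a point outside lies on no
    edge.\<close>
  then have "{e \<in> edges G. x \<in> ends G e} = {}" using G by (auto simp: finite_graph_def)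
  then show ?thesis unfolding degree_def by (metis card.empty le0)
qed

lemma card_neighbors_le_degree: "card (neighbors G x) \<le> degree G x"
proof -
  have "card (neighbors G x) \<le> (\<Sum>g\<in>{g \<in> edges G. x \<in> ends G g}. card (ends G g - {x}))"
    unfolding neighbors_eq by (rule card_UN_le) (simp add: finite_edges)
  also have "\<dots> = (\<Sum>g\<in>{g \<in> edges G. x \<in> ends G g}. 1)"
    using G by (intro sum.cong) (auto simp: finite_graph_def)
  finally show ?thesis by (simp add: degree_def)
qed

text \<open>Adjacency is symmetric, so the double sum over ends may be swapped.\<close>

lemma edge_weight_sym:
  assumes "e \<in> edges G" "f \<in> edges G"
  shows "edge_weight G e f = edge_weight G f e"
proof -
  have *: "edge_weight G e f = (\<Sum>x\<in>ends G e. \<Sum>y\<in>ends G f. if y \<in> neighbors G x then 1 else 0)"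
    if "f \<in> edges G" for e f
    unfolding edge_weight_def using finite_ends[OF that]
    by (intro sum.cong) (auto simp: sum.If_cases Int_commute)
  have "y \<in> neighbors G x \<longleftrightarrow> x \<in> neighbors G y" for x y
    by (simp add: neighbors_def insert_commute)
  then show ?thesis
    unfolding *[OF assms(1)] *[OF assms(2)] by (subst sum.swap) simp
qed

text \<open>Double counting of pairs \<open>(y, f)\<close> with \<open>y\<close> a neighbor of
  \<open>x\<close> and \<open>f\<close> an edge at \<open>y\<close>: there are at most
  \<open>max_degree G\<close> choices of \<open>y\<close>, each on at most
  \<open>max_degree G\<close> edges.\<close>

lemma sum_card_neighbors_le:
  "(\<Sum>f\<in>edges G. card (neighbors G x \<inter> ends G f)) \<le> (max_degree G)\<^sup>2"
proof -
  have "(\<Sum>f\<in>edges G. card (neighbors G x \<inter> ends G f)) =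
      (\<Sum>f\<in>edges G. \<Sum>y\<in>neighbors G x. if y \<in> ends G f then 1 else 0)"
    using finite_neighbors by (simp add: sum.If_cases)
  also have "\<dots> = (\<Sum>y\<in>neighbors G x. degree G y)"
    by (subst sum.swap) (simp add: degree_def sum.If_cases finite_edges Collect_conj_eq)
  also have "\<dots> \<le> card (neighbors G x) * max_degree G"
    using sum_bounded_above[of "neighbors G x" "degree G" "max_degree G"] degree_le_max_degree
    by simp
  also have "\<dots> \<le> (max_degree G)\<^sup>2"
    using le_trans[OF card_neighbors_le_degree degree_le_max_degree]
    by (simp add: power2_eq_square)
  finally show ?thesis .
qed

text \<open>If \<open>x\<close> is the common end, its neighbor is the other end of
  \<open>f\<close>; otherwise the common end itself is a neighbor of \<open>x\<close> through
  \<open>e\<close>. The case \<open>f = e\<close> is allowed.\<close>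

lemma card_neighbors_Int_incident:
  assumes ef: "e \<in> edges G" "f \<in> edges G" and meet: "ends G e \<inter> ends G f \<noteq> {}"
    and x: "x \<in> ends G e"
  shows "card (neighbors G x \<inter> ends G f) \<ge> 1"
proof -
  obtain u where u: "u \<in> ends G e" "u \<in> ends G f" using meet by blast
  have "neighbors G x \<inter> ends G f \<noteq> {}"
  proof (cases "x = u")
    case True
    obtain y where "ends G f = {u, y}" using ends_other[OF ef(2) u(2)] by blast
    then show ?thesis using True ef(2) by (auto simp: neighbors_def)
  next
    case False
    then have "ends G e = {x, u}" using ends_other[OF ef(1) x] u(1) by blast
    then show ?thesis using u(2) ef(1) by (auto simp: neighbors_def)
  qed
  then show ?thesis
    using finite_ends[OF ef(2)] by (simp add: Suc_le_eq card_gt_0_iff)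
qed

text \<open>Each end of \<open>e\<close> contributes at most the squared maximum degree over all
  edges. Omitting \<open>e\<close> itself removes at least 1 per end, which gives the strict
  inequality that later forces weight at most 1.\<close>

lemma sum_edge_weight_less:
  assumes e: "e \<in> edges G"
  shows "(\<Sum>f\<in>edges G - {e}. edge_weight G e f) < 2 * (max_degree G)\<^sup>2"
proof -
  have less: "(\<Sum>f\<in>edges G - {e}. card (neighbors G x \<inter> ends G f)) < (max_degree G)\<^sup>2"
    if x: "x \<in> ends G e" for x
  proof -
    have "card (neighbors G x \<inter> ends G e) \<ge> 1"
      using card_neighbors_Int_incident[OF e e _ x] x by blast
    then show ?thesis
      using sum_card_neighbors_le[of x] sum.remove[OF finite_edges e,
          of "\<lambda>f. card (neighbors G x \<inter> ends G f)"] by linarith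
  qed
  have card: "card (ends G e) = 2" using G e by (simp add: finite_graph_def)
  then have ne: "ends G e \<noteq> {}" by auto
  have "(\<Sum>f\<in>edges G - {e}. edge_weight G e f) =
      (\<Sum>x\<in>ends G e. \<Sum>f\<in>edges G - {e}. card (neighbors G x \<inter> ends G f))"
    unfolding edge_weight_def by (rule sum.swap)
  also have "\<dots> < (\<Sum>x\<in>ends G e. (max_degree G)\<^sup>2)"
    by (rule sum_strict_mono[OF finite_ends[OF e] ne less])
  finally show ?thesis by (simp add: card)
qed

section \<open>From small weight to semistrong color classes\<close>

lemma edge_weight_incident:
  assumes "e \<in> edges G" "f \<in> edges G" "ends G e \<inter> ends G f \<noteq> {}"
  shows "edge_weight G e f \<ge> 2"
proof -
  have "(\<Sum>x\<in>ends G e. 1) \<le> edge_weight G e f"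
    unfolding edge_weight_def using assms by (intro sum_mono card_neighbors_Int_incident)
  then show ?thesis using G assms(1) by (simp add: finite_graph_def)
qed

text \<open>Incident edges of equal color would already have weight 2. For a single edge, total
  weight at most 1 spread over two ends leaves an end with weight 0, and this end has degree one in
  the induced subgraph.\<close>

lemma semistrong_edge_coloring_if_small_weight:
  assumes small: "\<And>e. e \<in> edges G \<Longrightarrow>
    (\<Sum>f\<in>{f \<in> edges G - {e}. c f = c e}. edge_weight G e f) \<le> 1"
  shows "semistrong_edge_coloring G c"
proof -
  have disj: "ends G e \<inter> ends G f = {}"
    if ef: "e \<in> edges G" "f \<in> edges G" "e \<noteq> f" "c e = c f" for e f
  proof (rule ccontr)
    assume "ends G e \<inter> ends G f \<noteq> {}"
    then have "2 \<le> edge_weight G e f" using edge_weight_incident ef by blast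
    also have "\<dots> \<le> (\<Sum>f\<in>{f \<in> edges G - {e}. c f = c e}. edge_weight G e f)"
      using ef finite_edges by (intro member_le_sum) auto
    finally show False using small[OF ef(1)] by simp
  qed
  have "semistrong_matching (underlying_simple G) (ends G ` color_class G c i)" for i
  proof -
    let ?M = "color_class G c i"
    let ?V = "\<Union>f\<in>?M. ends G f"
    have single: "\<exists>v\<in>ends G e. {h \<in> ends G ` edges G. h \<subseteq> ?V \<and> v \<in> h} = {ends G e}" if e: "e \<in> ?M" for e
    proof -
      have eG: "e \<in> edges G" and M: "{f \<in> edges G - {e}. c f = c e} = ?M - {e}"
        using e by (auto simp: color_class_def)
      have finM: "finite (?M - {e})" using finite_edges by (simp add: color_class_def)
      have "\<exists>v\<in>ends G e. (\<Sum>f\<in>?M - {e}. card (neighbors G v \<inter> ends G f)) = 0"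
      proof (rule ccontr)
        assume "\<not> ?thesis"
        then have "(\<Sum>v\<in>ends G e. 1) \<le>
            (\<Sum>v\<in>ends G e. \<Sum>f\<in>?M - {e}. card (neighbors G v \<inter> ends G f))"
          by (intro sum_mono) (metis One_nat_def Suc_le_eq neq0_conv)
        also have "\<dots> = (\<Sum>f\<in>?M - {e}. edge_weight G e f)"
          unfolding edge_weight_def by (rule sum.swap)
        finally show False using small[OF eG] G eG unfolding M by (simp add: finite_graph_def)
      qed
      then obtain v where v: "v \<in> ends G e"
        and "(\<Sum>f\<in>?M - {e}. card (neighbors G v \<inter> ends G f)) = 0" by blast
      then have iso: "neighbors G v \<inter> ends G f = {}" if "f \<in> ?M - {e}" for f
        using finM finite_neighbors that by simp
      \<comment> \<open>The other end \<open>y\<close> of \<open>h\<close> is a neighbor of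
        \<open>v\<close> inside \<open>?V\<close>; by \<open>iso\<close> it lies on no other edge of
        the class, so it is an end of \<open>e\<close>.\<close>
      have "h = ends G e" if h: "h \<in> ends G ` edges G" "h \<subseteq> ?V" "v \<in> h" for h
      proof -
        obtain g where g: "g \<in> edges G" "h = ends G g" using h(1) by blast
        obtain y where y: "y \<noteq> v" "h = {v, y}" using ends_other[OF g(1)] g(2) h(3) by metis
        then have "y \<in> neighbors G v" using g by (auto simp: neighbors_def)
        then have "y \<in> ends G e" using iso y(2) h(2) by blast
        then show ?thesis using ends_other[OF eG v] y by blast
      qed
      moreover have "ends G e \<subseteq> ?V" using e by blast
      ultimately show ?thesis using v eG by blast
    qed
    have deg: "degree (induced_subgraph (underlying_simple G)
        (endvertices (underlying_simple G) (ends G ` ?M))) v =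
        card {h \<in> ends G ` edges G. h \<subseteq> ?V \<and> v \<in> h}" for v
      by (simp add: degree_def induced_subgraph_def underlying_simple_def endvertices_def)
    have "\<exists>v\<in>ends G e. degree (induced_subgraph (underlying_simple G)
        (endvertices (underlying_simple G) (ends G ` ?M))) v = 1" if "e \<in> ?M" for e
      unfolding deg using single[OF that]
      by (metis (no_types, lifting) is_singletonI is_singleton_altdef)
    moreover have "ends G e \<inter> ends G f = {}"
      if "e \<in> ?M" "f \<in> ?M" "ends G e \<noteq> ends G f" for e f
      using that disj[of e f] by (cases "e = f") (simp_all add: color_class_def)
    then have "matching (underlying_simple G) (ends G ` ?M)"
      by (simp add: matching_def underlying_simple_def image_mono color_class_def)
    ultimately show ?thesis
      by (simp add: semistrong_matching_def) (simp add: underlying_simple_def)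
  qed
  moreover have "proper_edge_coloring G c"
    unfolding proper_edge_coloring_def using disj by blast
  ultimately show ?thesis by (simp add: semistrong_edge_coloring_def)
qed

end

section \<open>Combining the optimal coloring with the weight bound\<close>

theorem theorem1:
  fixes G :: "('v, 'e) multigraph"
  assumes "finite_graph G"
  shows "semistrong_chromatic_index G \<le> (max_degree G)\<^sup>2"
proof -
  let ?k = "(max_degree G)\<^sup>2"
  have "\<exists>c :: 'e \<Rightarrow> nat. semistrong_edge_coloring G c \<and> card (c ` edges G) \<le> ?k"
  proof (cases "edges G = {}")
    \<comment> \<open>Without edges \<open>?k\<close> is 0, so there is no color to choose from; but
      any coloring then has an empty set of used colors.\<close>
    case True
    then show ?thesis
      using semistrong_edge_coloring_inj[OF assms, of "\<lambda>_. 0"] by auto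
  next
    case False
    \<comment> \<open>A natural number lies strictly below \<open>2 * ?k\<close>.\<close>
    then have pos: "?k > 0" using sum_edge_weight_less[OF assms] by fastforce
    \<comment> \<open>Setting the weight to 0 off the edges makes it symmetric for all arguments,
      whereas \<open>edge_weight_sym\<close> covers edges only.\<close>
    define w where "w e f = (if e \<in> edges G \<and> f \<in> edges G then edge_weight G e f else 0)" for e f
    have sym: "w e f = w f e" for e f
      using edge_weight_sym[OF assms] by (simp add: w_def)
    obtain c :: "'e \<Rightarrow> nat" where c: "c ` edges G \<subseteq> {..<?k}"
      and opt: "\<And>e. e \<in> edges G \<Longrightarrow>
        ?k * (\<Sum>f\<in>{f \<in> edges G - {e}. c f = c e}. w e f) \<le> (\<Sum>f\<in>edges G - {e}. w e f)"
      by (rule exists_locally_optimal_coloring[where w = w, OF finite_edges[OF assms] sym pos]) blast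
    have "(\<Sum>f\<in>{f \<in> edges G - {e}. c f = c e}. edge_weight G e f) \<le> 1"
      if e: "e \<in> edges G" for e
    proof -
      have "?k * (\<Sum>f\<in>{f \<in> edges G - {e}. c f = c e}. edge_weight G e f) \<le>
          (\<Sum>f\<in>edges G - {e}. edge_weight G e f)"
        using opt[OF e] e by (simp add: w_def)
      also have "\<dots> < ?k * 2" using sum_edge_weight_less[OF assms e] by simp
      \<comment> \<open>Cancelling \<open>?k\<close> leaves a natural number below 2.\<close>
      finally show ?thesis by simp
    qed
    then have "semistrong_edge_coloring G c"
      by (rule semistrong_edge_coloring_if_small_weight[OF assms])
    moreover have "card (c ` edges G) \<le> ?k"
      using card_mono[OF _ c] by simp
    ultimately show ?thesis by blast
  qed
  then show ?thesis
    unfolding semistrong_chromatic_index_def by (rule Least_le)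
qed

end
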